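(* Let $H$ be a finite dimensional real Banach space. Assume that $J,\mu\in C^1(H,\mathbb{R})$, $\mu(x)\ge0$ for all $x\in H$, $\mu(0)=0$, and $\mu$ is coercive (i.e. $\mu(x)\to+\infty$ as $\|x\|\to\infty$). Let $0<r<s$ be constants. Assume that (1) $\liminf_{\mu(u)\to\infty}\frac{J(u)}{\mu(u)}\ge0$; (2) $\inf_{u\in H}J(u)<\inf_{\mu(u)\le s}J(u)$; (3) $J(0)\le\inf_{r\le\mu(u)\le s}J(u)$. Then there is $\lambda^\star>0$ such that the functional $u\mapsto\mu(u)+\lambda^\star J(u)$ has at least three critical points in $H$.
   Context: The infimum $\inf_{u\in H}J(u)$ is allowed to be $-\infty$. A critical point of a $C^1$ functional is a point where its derivative vanishes. *)

theory Defs
  imports "HOL-Analysis.Analysis"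
begin

text \<open>
  The class \<open>euclidean_space\<close> would force the norm to come from an inner product, so
  finite-dimensionality of a normed space is expressed by a finite spanning set.
\<close>

definition finite_dimensional :: "'a::real_vector set \<Rightarrow> bool" where
  "finite_dimensional V \<longleftrightarrow> (\<exists>B. finite B \<and> span B = V)"

text \<open>Continuity of the derivative is with respect to the operator norm on the dual space.\<close>

definition C1_functional :: "('a::real_normed_vector \<Rightarrow> real) \<Rightarrow> bool" where
  "C1_functional f \<longleftrightarrow>
     (\<exists>f' :: 'a \<Rightarrow> ('a \<Rightarrow>\<^sub>L real).
        (\<forall>x. (f has_derivative blinfun_apply (f' x)) (at x)) \<and> continuous_on UNIV f')"

definition critical_point :: "('a::real_normed_vector \<Rightarrow> real) \<Rightarrow> 'a \<Rightarrow> bool" where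
  "critical_point f u \<longleftrightarrow> (f has_derivative (\<lambda>_. 0)) (at u)"

end

theory Submission
  imports Defs
begin

text \<open>
  Write \<open>I = \<mu> + l * J\<close>. By (1) and the coercivity of \<open>\<mu>\<close>, \<open>I\<close> is coercive for every \<open>l > 0\<close>, so
  in finite dimension its sublevel sets are compact. Three critical points arise as follows.

  \<^item> On the region \<open>r \<le> \<mu> \<le> s\<close>, hypothesis (3) gives \<open>I \<ge> r + l * J 0 > I 0\<close>. Hence the minimum of
    \<open>I\<close> over the compact set \<open>\<mu> \<le> s\<close> is attained where \<open>\<mu> < r\<close>, and is a local minimum.

  \<^item> By (2) some point has \<open>J\<close> below the infimum of \<open>J\<close> over \<open>\<mu> \<le> s\<close>. For large \<open>l\<close> the term
    \<open>l * J\<close> dominates there, so the global minimum of \<open>I\<close> lies where \<open>\<mu> > s\<close>.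

  \<^item> Any path joining these two minima crosses the level \<open>\<mu> = r\<close>, where \<open>I \<ge> r + l * J 0\<close>, a
    value larger than \<open>I\<close> at either minimum. The mountain pass principle yields a critical point
    at or above that value.

  The mountain pass principle (\<open>mountain_pass\<close>) is proved without a gradient flow. The field
  \<open>V x = (\<Sum>b\<in>B. f' x b *\<^sub>R b)\<close>, with \<open>B\<close> a finite spanning set, satisfies \<open>f' x (V x) = \<Sum> (f' x b)\<^sup>2\<close>
  and so plays the part of a gradient. One explicit step \<open>x \<mapsto> x - t *\<^sub>R V x\<close> is continuous, and
  since \<open>V\<close> vanishes at critical points it fixes endpoints of paths that are critical. Applying a
  step of size \<open>t\<close> to a path whose maximum is within \<open>t\<^sup>2\<close> of the minimax level cannot bring the
  maximum down by much, which produces a point where the rate of decrease is at most \<open>2 * t\<close>.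
  As \<open>t \<rightarrow> 0\<close> these points accumulate at a critical point.
\<close>

section \<open>Compactness in finite-dimensional normed spaces\<close>

text \<open>
  Adding one vector \<open>b\<close> to a subspace \<open>S\<close> with the Bolzano-Weierstrass property preserves it: \<open>S\<close> is
  closed, so \<open>b\<close> has positive distance \<open>d\<close> from it, and \<open>norm (y + a *\<^sub>R b) \<ge> \<bar>a\<bar> * d\<close> for \<open>y \<in> S\<close>.
  The coefficients along \<open>b\<close> of a bounded sequence are therefore bounded as well.
\<close>

lemma span_bounded_sequence_subsequence:
  fixes B :: "'a::real_normed_vector set"
  assumes "finite B" and "range f \<subseteq> span B" and "bounded (range f)"
  shows "\<exists>l\<in>span B. \<exists>k::nat\<Rightarrow>nat. strict_mono k \<and> (f \<circ> k) \<longlonglongrightarrow> l"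
  using assms
proof (induction B arbitrary: f rule: finite_induct)
  case empty
  then have "f = (\<lambda>_. 0)" by auto
  then show ?case by (intro bexI[of _ 0] exI[of _ id]) (simp_all add: strict_mono_def o_def)
next
  case (insert b B)
  show ?case
  proof (cases "b \<in> span B")
    case True
    then have "span (insert b B) = span B" by (rule span_redundant)
    then show ?thesis using insert.IH[of f] insert.prems by simp
  next
    case False
    have "closed (span B)"
      unfolding closed_sequential_limits
    proof (intro allI impI, elim conjE)
      fix x l assume x: "\<forall>n. x n \<in> span B" and l: "x \<longlonglongrightarrow> l"
      have "bounded (range x)" using l by (rule convergent_imp_bounded)
      with x obtain l' k where "l' \<in> span B" "strict_mono (k::nat\<Rightarrow>nat)" "(x \<circ> k) \<longlonglongrightarrow> l'"
        using insert.IH[of x] by blast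
      moreover from this have "(x \<circ> k) \<longlonglongrightarrow> l" using l LIMSEQ_subseq_LIMSEQ by blast
      ultimately show "l \<in> span B" using LIMSEQ_unique by blast
    qed
    moreover have "span B \<noteq> {}" using span_zero by blast
    ultimately have d: "infdist b (span B) > 0" (is "?d > 0")
      using False in_closed_iff_infdist_zero infdist_nonneg[of b "span B"]
      by (metis less_eq_real_def)
    have low: "\<bar>a\<bar> * ?d \<le> norm (y + a *\<^sub>R b)" if "y \<in> span B" for a y
    proof (cases "a = 0")
      case False
      have "?d \<le> dist b (- (1/a) *\<^sub>R y)" by (intro infdist_le span_scale that)
      then have "\<bar>a\<bar> * ?d \<le> \<bar>a\<bar> * norm (b + (1/a) *\<^sub>R y)"
        by (simp add: dist_norm mult_left_mono)
      also have "\<dots> = norm (a *\<^sub>R (b + (1/a) *\<^sub>R y))" by simp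
      also have "a *\<^sub>R (b + (1/a) *\<^sub>R y) = y + a *\<^sub>R b"
        using False by (simp add: scaleR_add_right)
      finally show ?thesis .
    qed simp
    have "\<exists>a. f n - a *\<^sub>R b \<in> span B" for n
      using insert.prems(1) span_breakdown_eq[of "f n" b B] by blast
    then obtain a where a: "\<And>n. f n - a n *\<^sub>R b \<in> span B" by metis
    obtain M where M: "\<And>n. norm (f n) \<le> M"
      using insert.prems(2) unfolding bounded_iff by auto
    have a_le: "\<bar>a n\<bar> \<le> M / ?d" for n
      using low[OF a, of "a n" n] M[of n] d by (simp add: pos_le_divide_eq)
    then have "bounded (range a)" unfolding bounded_iff by auto
    then obtain \<alpha> k where k: "strict_mono (k::nat\<Rightarrow>nat)" "(a \<circ> k) \<longlonglongrightarrow> \<alpha>"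
      using bounded_imp_convergent_subsequence by blast
    let ?g = "\<lambda>n. f (k n) - a (k n) *\<^sub>R b"
    have "norm (?g n) \<le> M + M / ?d * norm b" for n
    proof -
      have "norm (?g n) \<le> norm (f (k n)) + \<bar>a (k n)\<bar> * norm b"
        using norm_triangle_ineq4[of "f (k n)" "a (k n) *\<^sub>R b"] by simp
      also have "\<dots> \<le> M + M / ?d * norm b"
        by (intro add_mono M mult_right_mono a_le) simp
      finally show ?thesis .
    qed
    then have "bounded (range ?g)" unfolding bounded_iff by blast
    moreover have "range ?g \<subseteq> span B" using a by blast
    ultimately obtain l j where j: "l \<in> span B" "strict_mono (j::nat\<Rightarrow>nat)" "(?g \<circ> j) \<longlonglongrightarrow> l"
      using insert.IH[of ?g] by blast
    have "((a \<circ> k) \<circ> j) \<longlonglongrightarrow> \<alpha>" using k(2) j(2) by (rule LIMSEQ_subseq_LIMSEQ)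
    then have "(\<lambda>n. (?g \<circ> j) n + ((a \<circ> k) \<circ> j) n *\<^sub>R b) \<longlonglongrightarrow> l + \<alpha> *\<^sub>R b"
      using j(3) by (intro tendsto_intros)
    then have "(f \<circ> (k \<circ> j)) \<longlonglongrightarrow> l + \<alpha> *\<^sub>R b" by (simp add: o_def)
    moreover have "l + \<alpha> *\<^sub>R b \<in> span (insert b B)"
      using j(1) span_breakdown_eq[of "l + \<alpha> *\<^sub>R b" b B] by (auto intro!: exI[of _ \<alpha>])
    ultimately show ?thesis using strict_mono_o[OF k(1) j(2)] by blast
  qed
qed

lemma finite_dimensional_bounded_closed_imp_compact:
  fixes S :: "'a::real_normed_vector set"
  assumes "finite_dimensional (UNIV :: 'a set)" and "bounded S" and "closed S"
  shows "compact S"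
  unfolding compact_def
proof (intro allI impI)
  fix f :: "nat \<Rightarrow> 'a" assume f: "\<forall>n. f n \<in> S"
  obtain B :: "'a set" where B: "finite B" "span B = UNIV"
    using assms(1) unfolding finite_dimensional_def by blast
  have "bounded (range f)" using f by (intro bounded_subset[OF assms(2)]) auto
  with B obtain l k where "strict_mono (k::nat\<Rightarrow>nat)" "(f \<circ> k) \<longlonglongrightarrow> l"
    using span_bounded_sequence_subsequence[of B f] by auto
  moreover from this have "l \<in> S"
    using closed_sequentially[OF assms(3), of "f \<circ> k"] f by simp
  ultimately show "\<exists>l\<in>S. \<exists>r. strict_mono r \<and> (f \<circ> r) \<longlonglongrightarrow> l" by blast
qed

section \<open>Critical points of continuously differentiable functionals\<close>

lemma C1_functional_continuous:
  assumes "C1_functional f"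
  shows "continuous_on UNIV f"
proof -
  obtain f' where "\<And>x. (f has_derivative blinfun_apply (f' x)) (at x)"
    using assms unfolding C1_functional_def by blast
  then show ?thesis by (intro continuous_at_imp_continuous_on ballI has_derivative_continuous)
qed

lemma C1_functional_add_scaled:
  assumes "C1_functional f" and "C1_functional g"
  shows "C1_functional (\<lambda>x. f x + l * g x)"
proof -
  obtain f' where f: "\<And>x. (f has_derivative blinfun_apply (f' x)) (at x)" "continuous_on UNIV f'"
    using assms(1) unfolding C1_functional_def by blast
  obtain g' where g: "\<And>x. (g has_derivative blinfun_apply (g' x)) (at x)" "continuous_on UNIV g'"
    using assms(2) unfolding C1_functional_def by blast
  have "((\<lambda>x. f x + l * g x) has_derivative blinfun_apply (f' x + l *\<^sub>R g' x)) (at x)" for x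
    by (rule has_derivative_eq_rhs, rule has_derivative_add[OF f(1)],
        rule has_derivative_mult_right[OF g(1)])
      (auto simp: blinfun.add_left blinfun.scaleR_left)
  moreover have "continuous_on UNIV (\<lambda>x. f' x + l *\<^sub>R g' x)"
    using f(2) g(2) by (intro continuous_intros)
  ultimately show ?thesis
    unfolding C1_functional_def by (intro exI[of _ "\<lambda>x. f' x + l *\<^sub>R g' x"] conjI allI)
qed

lemma critical_point_if_local_min:
  assumes "C1_functional f" and "open S" and "u \<in> S" and "\<And>x. x \<in> S \<Longrightarrow> f u \<le> f x"
  shows "critical_point f u"
proof -
  obtain f' where f: "(f has_derivative blinfun_apply (f' u)) (at u)"
    using assms(1) unfolding C1_functional_def by blast
  have "eventually (\<lambda>x. f u \<le> f x) (at u)"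
    using eventually_at_topological assms(2-4) by blast
  then have "blinfun_apply (f' u) = (\<lambda>_. 0)" using has_derivative_local_min[OF f] by blast
  then show ?thesis using f unfolding critical_point_def by simp
qed

section \<open>The mountain pass principle\<close>

text \<open>
  The minimax level \<open>c\<close> is the infimum of the heights \<open>b\<close> such that \<open>u\<close> and \<open>v\<close> are joined by a path
  inside the sublevel set \<open>f \<le> b\<close>. Because \<open>u\<close> and \<open>v\<close> are critical, the descent step fixes them, so it
  maps paths from \<open>u\<close> to \<open>v\<close> to such paths without any cut-off near the endpoints.
\<close>

lemma mountain_pass:
  fixes f :: "'a::real_normed_vector \<Rightarrow> real"
  assumes fin: "finite_dimensional (UNIV :: 'a set)"
    and C1: "C1_functional f"
    and coercive: "\<And>b. bounded {x. f x \<le> b}"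
    and u: "critical_point f u" and v: "critical_point f v"
    and barrier: "\<And>g. path g \<Longrightarrow> pathstart g = u \<Longrightarrow> pathfinish g = v \<Longrightarrow> \<exists>x\<in>path_image g. m \<le> f x"
  shows "\<exists>w. critical_point f w \<and> m \<le> f w"
proof -
  obtain f' where f': "\<And>x. (f has_derivative blinfun_apply (f' x)) (at x)"
    and f'_cont: "continuous_on UNIV f'"
    using C1 unfolding C1_functional_def by blast
  have f_cont: "continuous_on UNIV f" using C1 by (rule C1_functional_continuous)
  obtain B :: "'a set" where B: "finite B" "span B = UNIV"
    using fin unfolding finite_dimensional_def by blast
  define V where "V x = (\<Sum>b\<in>B. blinfun_apply (f' x) b *\<^sub>R b)" for x
  have V_cont: "continuous_on UNIV V"
    unfolding V_def using f'_cont by (intro continuous_intros)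
  have f'_V: "blinfun_apply (f' x) (V x) = (\<Sum>b\<in>B. (blinfun_apply (f' x) b)\<^sup>2)" for x
    unfolding V_def by (simp add: blinfun.sum_right blinfun.scaleR_right power2_eq_square)
  have V_critical: "V x = 0" if "critical_point f x" for x
  proof -
    have "blinfun_apply (f' x) = (\<lambda>_. 0)"
      using that f'[of x] unfolding critical_point_def by (rule has_derivative_unique[symmetric])
    then show ?thesis unfolding V_def by simp
  qed

  define joined where "joined b \<longleftrightarrow>
    (\<exists>g. path g \<and> pathstart g = u \<and> pathfinish g = v \<and> (\<forall>x\<in>path_image g. f x \<le> b))" for b
  define c where "c = Inf {b. joined b}"
  have m_le: "m \<le> b" if "joined b" for b
    using that barrier unfolding joined_def by force
  have "compact (f ` path_image (linepath u v))"
    by (intro compact_continuous_image continuous_on_subset[OF f_cont] compact_path_image) auto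
  then have "bdd_above (f ` path_image (linepath u v))"
    by (intro bounded_imp_bdd_above compact_imp_bounded)
  then obtain b0 where "\<And>x. x \<in> path_image (linepath u v) \<Longrightarrow> f x \<le> b0"
    unfolding bdd_above_def by blast
  then have "joined b0"
    unfolding joined_def by (intro exI[of _ "linepath u v"]) auto
  then have nonempty: "{b. joined b} \<noteq> {}" by blast
  have bdd: "bdd_below {b. joined b}" using m_le unfolding bdd_below_def by blast
  have m_c: "m \<le> c" unfolding c_def using nonempty m_le by (intro cInf_greatest) auto
  have c_le: "c \<le> b" if "joined b" for b
    unfolding c_def using that bdd by (simp add: cInf_lower)

  define t where "t n = inverse (real (Suc n))" for n
  have t_pos: "t n > 0" for n unfolding t_def by simp
  have t_lim: "t \<longlonglongrightarrow> 0" unfolding t_def by (rule LIMSEQ_inverse_real_of_nat)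
  have "\<exists>x. f x \<le> c + (t n)\<^sup>2 \<and> c - (t n)\<^sup>2 < f (x - t n *\<^sub>R V x)" for n
  proof -
    obtain b where "joined b" "b < c + (t n)\<^sup>2"
      using cInf_lessD[OF nonempty, of "c + (t n)\<^sup>2"] t_pos[of n] unfolding c_def by auto
    then obtain g where g: "path g" "pathstart g = u" "pathfinish g = v"
      "\<And>x. x \<in> path_image g \<Longrightarrow> f x \<le> c + (t n)\<^sup>2"
      unfolding joined_def by fastforce
    let ?\<eta> = "\<lambda>x. x - t n *\<^sub>R V x"
    have "continuous_on UNIV ?\<eta>" using V_cont by (intro continuous_intros)
    then have "path (?\<eta> \<circ> g)"
      using g(1) path_continuous_image continuous_on_subset[OF _ subset_UNIV] by blast
    moreover have "pathstart (?\<eta> \<circ> g) = u" "pathfinish (?\<eta> \<circ> g) = v"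
      using g(2,3) V_critical[OF u] V_critical[OF v] by (simp_all add: pathstart_compose pathfinish_compose)
    moreover have "\<not> joined (c - (t n)\<^sup>2)" using c_le[of "c - (t n)\<^sup>2"] t_pos[of n] by auto
    ultimately have "\<not> (\<forall>y\<in>path_image (?\<eta> \<circ> g). f y \<le> c - (t n)\<^sup>2)"
      unfolding joined_def by blast
    then obtain y where y: "y \<in> path_image (?\<eta> \<circ> g)" "c - (t n)\<^sup>2 < f y"
      by (auto simp: not_le)
    then show ?thesis using g(4) by (auto simp: path_image_compose)
  qed
  then obtain x where x_le: "\<And>n. f (x n) \<le> c + (t n)\<^sup>2"
    and x_step: "\<And>n. c - (t n)\<^sup>2 < f (x n - t n *\<^sub>R V (x n))" by metis

  \<comment> \<open>By the mean value theorem the small loss of height over the whole step becomes a bound on the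
    derivative at one point of the step; along a subsequence this point has the same limit as \<open>x n\<close>.\<close>
  have "\<exists>\<theta>. 0 < \<theta> \<and> \<theta> < t n \<and>
      blinfun_apply (f' (x n - \<theta> *\<^sub>R V (x n))) (V (x n)) \<le> 2 * t n" for n
  proof -
    let ?y = "\<lambda>\<theta>. x n - \<theta> *\<^sub>R V (x n)"
    have D: "((\<lambda>\<theta>. f (?y \<theta>)) has_real_derivative - blinfun_apply (f' (?y \<theta>)) (V (x n))) (at \<theta>)" for \<theta>
    proof -
      have "(?y has_derivative (\<lambda>h. - (h *\<^sub>R V (x n)))) (at \<theta>)"
        by (auto intro!: derivative_eq_intros)
      from has_derivative_compose[OF this f'] show ?thesis
        by (rule has_derivative_imp_has_field_derivative)
          (simp add: blinfun.minus_right blinfun.scaleR_right)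
    qed
    obtain \<theta> where \<theta>: "0 < \<theta>" "\<theta> < t n"
      "f (?y (t n)) - f (?y 0) = (t n - 0) * - blinfun_apply (f' (?y \<theta>)) (V (x n))"
      using MVT2[OF t_pos[of n] D] by auto
    then have "t n * blinfun_apply (f' (?y \<theta>)) (V (x n)) = f (x n) - f (?y (t n))" by simp
    also have "\<dots> \<le> 2 * (t n)\<^sup>2" using x_le[of n] x_step[of n] by linarith
    also have "\<dots> = t n * (2 * t n)" by (simp add: power2_eq_square)
    finally show ?thesis using \<theta>(1,2) t_pos[of n] by auto
  qed
  then obtain \<theta> where \<theta>: "\<And>n. 0 < \<theta> n" "\<And>n. \<theta> n < t n"
    and slope: "\<And>n. blinfun_apply (f' (x n - \<theta> n *\<^sub>R V (x n))) (V (x n)) \<le> 2 * t n"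
    by metis

  have "compact {y. f y \<le> c + 1}"
    by (intro finite_dimensional_bounded_closed_imp_compact fin coercive
        closed_Collect_le f_cont continuous_intros)
  moreover have "x n \<in> {y. f y \<le> c + 1}" for n
  proof -
    have "(t n)\<^sup>2 \<le> 1" unfolding t_def by (intro power_le_one) (auto simp: field_simps)
    then show ?thesis using x_le[of n] by simp
  qed
  ultimately obtain w k where k: "strict_mono (k::nat\<Rightarrow>nat)" and "(x \<circ> k) \<longlonglongrightarrow> w"
    unfolding compact_def by meson
  then have x_lim: "(\<lambda>n. x (k n)) \<longlonglongrightarrow> w" by (simp add: o_def)
  have tk_lim: "(\<lambda>n. t (k n)) \<longlonglongrightarrow> 0"
    using LIMSEQ_subseq_LIMSEQ[OF t_lim k] by (simp add: o_def)
  have "(\<lambda>n. \<theta> (k n)) \<longlonglongrightarrow> 0"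
    by (intro tendsto_sandwich[OF _ _ tendsto_const tk_lim] always_eventually allI less_imp_le \<theta>)
  moreover have Vx_lim: "(\<lambda>n. V (x (k n))) \<longlonglongrightarrow> V w"
    using continuous_on_tendsto_compose[OF V_cont x_lim] by simp
  ultimately have "(\<lambda>n. x (k n) - \<theta> (k n) *\<^sub>R V (x (k n))) \<longlonglongrightarrow> w - 0 *\<^sub>R V w"
    using x_lim by (intro tendsto_intros)
  then have "(\<lambda>n. f' (x (k n) - \<theta> (k n) *\<^sub>R V (x (k n)))) \<longlonglongrightarrow> f' w"
    using continuous_on_tendsto_compose[OF f'_cont] by fastforce
  then have "(\<lambda>n. blinfun_apply (f' (x (k n) - \<theta> (k n) *\<^sub>R V (x (k n)))) (V (x (k n))))
      \<longlonglongrightarrow> blinfun_apply (f' w) (V w)"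
    using Vx_lim by (intro tendsto_intros)
  moreover have "(\<lambda>n. 2 * t (k n)) \<longlonglongrightarrow> 2 * 0" using tk_lim by (intro tendsto_intros)
  ultimately have "blinfun_apply (f' w) (V w) \<le> 2 * 0"
    by (rule LIMSEQ_le) (use slope in blast)
  then have "(\<Sum>b\<in>B. (blinfun_apply (f' w) b)\<^sup>2) = 0"
    using f'_V[of w] by (simp add: sum_nonneg antisym)
  then have "\<And>b. b \<in> B \<Longrightarrow> blinfun_apply (f' w) b = 0"
    using B(1) by (simp add: sum_nonneg_eq_0_iff)
  then have "blinfun_apply (f' w) y = 0" for y
    using linear_eq_0_on_span[of "blinfun_apply (f' w)" B y] B(2)
    by (simp add: blinfun.bounded_linear_right bounded_linear.linear)
  then have "blinfun_apply (f' w) = (\<lambda>_. 0)" by auto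
  then have "critical_point f w" using f'[of w] unfolding critical_point_def by simp

  moreover have "m \<le> f w"
  proof -
    have "(\<lambda>n. x (k n) - t (k n) *\<^sub>R V (x (k n))) \<longlonglongrightarrow> w - 0 *\<^sub>R V w"
      using x_lim tk_lim Vx_lim by (intro tendsto_intros)
    then have lim: "(\<lambda>n. f (x (k n) - t (k n) *\<^sub>R V (x (k n)))) \<longlonglongrightarrow> f w"
      using continuous_on_tendsto_compose[OF f_cont] by fastforce
    have "(\<lambda>n. c - (t (k n))\<^sup>2) \<longlonglongrightarrow> c - 0\<^sup>2" using tk_lim by (intro tendsto_intros)
    from this lim have "c - 0\<^sup>2 \<le> f w"
      by (rule LIMSEQ_le) (use x_step less_imp_le in blast)
    then show ?thesis using m_c by simp
  qed
  ultimately show ?thesis by blast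
qed

section \<open>Coercive functionals and the three critical points\<close>

text \<open>
  Far out, \<open>J \<ge> - \<mu> / (2 * l)\<close>, so that \<open>\<mu> + l * J \<ge> \<mu> / 2\<close> inherits the coercivity of \<open>\<mu>\<close>.
\<close>

lemma filterlim_add_scaled_at_top:
  fixes J \<mu> :: "'a \<Rightarrow> real"
  assumes "filterlim \<mu> at_top F"
    and "Liminf (filtercomap \<mu> at_top) (\<lambda>u. ereal (J u / \<mu> u)) \<ge> 0" and "l > 0"
  shows "filterlim (\<lambda>x. \<mu> x + l * J x) at_top F"
proof -
  have "ereal (- 1 / (2 * l)) < 0" using assms(3) by simp
  then have "eventually (\<lambda>u. ereal (- 1 / (2 * l)) < ereal (J u / \<mu> u)) (filtercomap \<mu> at_top)"
    using assms(2) less_LiminfD less_le_trans by blast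
  then have "eventually (\<lambda>u. - 1 / (2 * l) < J u / \<mu> u) F"
    using assms(1) by (simp add: filterlim_iff_le_filtercomap filter_leD)
  moreover have "eventually (\<lambda>u. 0 < \<mu> u) F"
    using assms(1) filterlim_at_top_dense by blast
  ultimately have "eventually (\<lambda>u. (1/2) * \<mu> u \<le> \<mu> u + l * J u) F"
  proof eventually_elim
    case (elim u)
    then have "- 1 / (2 * l) * \<mu> u < J u" by (simp add: pos_less_divide_eq)
    then have "l * (- 1 / (2 * l) * \<mu> u) < l * J u"
      by (rule mult_strict_left_mono) (rule assms(3))
    then show ?case using assms(3) by simp
  qed
  moreover have "filterlim (\<lambda>u. (1/2) * \<mu> u) at_top F"
    using assms(1) by (intro filterlim_tendsto_pos_mult_at_top[OF tendsto_const]) auto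
  ultimately show ?thesis by (rule filterlim_at_top_mono[rotated])
qed

lemma coercive_bounded_sublevel:
  fixes f :: "'a::real_normed_vector \<Rightarrow> real"
  assumes "filterlim f at_top at_infinity"
  shows "bounded {x. f x \<le> b}"
proof -
  have "eventually (\<lambda>x. b < f x) at_infinity"
    using assms filterlim_at_top_dense by blast
  then obtain N where "\<And>x. N \<le> norm x \<Longrightarrow> b < f x"
    unfolding eventually_at_infinity by blast
  then have "norm x \<le> N" if "f x \<le> b" for x using that by (meson linear not_le)
  then show ?thesis unfolding bounded_iff by blast
qed

theorem theorem11:
  fixes J \<mu> :: "'a::banach \<Rightarrow> real" and r s :: real
  assumes "finite_dimensional (UNIV :: 'a set)"
    and "C1_functional J" and "C1_functional \<mu>"
    and "\<And>x. \<mu> x \<ge> 0" and "\<mu> 0 = 0"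
    and "filterlim \<mu> at_top at_infinity"
    and "0 < r" and "r < s"
    and "Liminf (filtercomap \<mu> at_top) (\<lambda>u. ereal (J u / \<mu> u)) \<ge> 0"
    and "(INF u. ereal (J u)) < (INF u\<in>{u. \<mu> u \<le> s}. ereal (J u))"
    and "ereal (J 0) \<le> (INF u\<in>{u. r \<le> \<mu> u \<and> \<mu> u \<le> s}. ereal (J u))"
  shows "\<exists>l>0. \<exists>u v w.
           u \<noteq> v \<and> u \<noteq> w \<and> v \<noteq> w \<and>
           critical_point (\<lambda>x. \<mu> x + l * J x) u \<and>
           critical_point (\<lambda>x. \<mu> x + l * J x) v \<and>
           critical_point (\<lambda>x. \<mu> x + l * J x) w"
proof -
  have \<mu>_cont: "continuous_on UNIV \<mu>" using assms(3) by (rule C1_functional_continuous)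
  have J_annulus: "J 0 \<le> J x" if "r \<le> \<mu> x" "\<mu> x \<le> s" for x
    using assms(11) that by (simp add: le_INF_iff)
  obtain p where p: "ereal (J p) < (INF u\<in>{u. \<mu> u \<le> s}. ereal (J u))"
    using assms(10) by (auto simp: INF_less_iff)
  have "(INF u\<in>{u. \<mu> u \<le> s}. ereal (J u)) \<le> ereal (J 0)"
    using assms(5,7,8) by (intro INF_lower) simp
  with p obtain k where k: "(INF u\<in>{u. \<mu> u \<le> s}. ereal (J u)) = ereal k"
    by (cases "INF u\<in>{u. \<mu> u \<le> s}. ereal (J u)") auto
  have J_inner: "k \<le> J x" if "\<mu> x \<le> s" for x
    using INF_lower[of x "{u. \<mu> u \<le> s}" "\<lambda>u. ereal (J u)"] that k by simp
  have p_k: "J p < k" using p k by simp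
  \<comment> \<open>Large enough for \<open>\<mu> p + l * J p\<close> to lie below \<open>l * k\<close>, a lower bound of the functional on \<open>\<mu> \<le> s\<close>.\<close>
  define l where "l = \<mu> p / (k - J p) + 1"
  have l: "l > 0" unfolding l_def using assms(4)[of p] p_k by (intro add_nonneg_pos) auto
  have "l * (k - J p) = \<mu> p + (k - J p)"
    unfolding l_def using p_k by (simp add: distrib_right)
  then have p_low: "\<mu> p + l * J p < l * k" using p_k by (simp add: right_diff_distrib)

  let ?I = "\<lambda>x. \<mu> x + l * J x"
  have C1: "C1_functional ?I" using assms(3,2) by (rule C1_functional_add_scaled)
  have I_cont: "continuous_on UNIV ?I" using C1 by (rule C1_functional_continuous)
  have I_bounded: "bounded {x. ?I x \<le> b}" for b
    by (intro coercive_bounded_sublevel filterlim_add_scaled_at_top assms l)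
  have I_annulus: "r + l * J 0 \<le> ?I x" if "r \<le> \<mu> x" "\<mu> x \<le> s" for x
    using that J_annulus[OF that] l by (intro add_mono mult_left_mono) auto

  have "compact {x. \<mu> x \<le> s}"
    by (intro finite_dimensional_bounded_closed_imp_compact assms(1)
        coercive_bounded_sublevel assms(6) closed_Collect_le \<mu>_cont continuous_intros)
  moreover have "0 \<in> {x. \<mu> x \<le> s}" using assms(5,7,8) by simp
  ultimately obtain u where u: "\<mu> u \<le> s" "\<And>x. \<mu> x \<le> s \<Longrightarrow> ?I u \<le> ?I x"
    using continuous_attains_inf[of "{x. \<mu> x \<le> s}" ?I] continuous_on_subset[OF I_cont] by blast
  have u0: "?I u \<le> l * J 0" using u(2)[of 0] assms(5,7,8) by simp
  have u_r: "\<mu> u < r" using I_annulus[of u] u(1) u0 assms(7) by linarith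
  have u_crit: "critical_point ?I u"
  proof (rule critical_point_if_local_min[OF C1])
    show "open {x. \<mu> x < s}" by (intro open_Collect_less \<mu>_cont continuous_intros)
  qed (use u u_r assms(8) in auto)

  have "compact {x. ?I x \<le> ?I 0}"
    by (intro finite_dimensional_bounded_closed_imp_compact assms(1) I_bounded
        closed_Collect_le I_cont continuous_intros)
  moreover have "0 \<in> {x. ?I x \<le> ?I 0}" by simp
  ultimately obtain v where v_le: "?I v \<le> ?I 0" and "\<And>x. ?I x \<le> ?I 0 \<Longrightarrow> ?I v \<le> ?I x"
    using continuous_attains_inf[of "{x. ?I x \<le> ?I 0}" ?I] continuous_on_subset[OF I_cont] by blast
  then have v: "?I v \<le> ?I x" for x by (meson linear order_trans)
  have v_crit: "critical_point ?I v"
    using v by (intro critical_point_if_local_min[OF C1 open_UNIV]) auto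
  have v_s: "s < \<mu> v"
  proof (rule ccontr)
    assume "\<not> s < \<mu> v"
    then have "l * k \<le> l * J v" using J_inner[of v] l by simp
    then show False using v[of p] p_low assms(4)[of v] by linarith
  qed

  have "\<exists>x\<in>path_image g. r + l * J 0 \<le> ?I x"
    if g: "path g" "pathstart g = u" "pathfinish g = v" for g
  proof -
    have "connected (\<mu> ` path_image g)"
      by (intro connected_continuous_image continuous_on_subset[OF \<mu>_cont]
          connected_path_image g(1)) auto
    moreover have "\<mu> u \<in> \<mu> ` path_image g" "\<mu> v \<in> \<mu> ` path_image g"
      using g pathstart_in_path_image[of g] pathfinish_in_path_image[of g] by auto
    ultimately have "r \<in> \<mu> ` path_image g"
      by (rule connectedD_interval) (use u_r v_s assms(8) in auto)
    then obtain x where "x \<in> path_image g" "\<mu> x = r" by auto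
    then show ?thesis using I_annulus[of x] assms(8) by force
  qed
  then obtain w where w: "critical_point ?I w" "r + l * J 0 \<le> ?I w"
    using mountain_pass[OF assms(1) C1 I_bounded u_crit v_crit] by blast

  have "u \<noteq> v" using u_r v_s assms(8) by auto
  moreover have "u \<noteq> w" using u0 w(2) assms(7) by auto
  moreover have "v \<noteq> w" using v_le w(2) assms(5,7) by auto
  ultimately show ?thesis using l u_crit v_crit w(1) by blast
qed

end
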